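(* Assume that $u_0\in H^2(\Omega)\cap H^1_0(\Omega)$ and $f\in L^\infty(0,T;L^2(\Omega))$, and that there is a constant $m_0>0$ with $M(s)\ge m_0$ for all $s\in(0,\infty)$ and $m_0-4L_MK^2>0$, where $K:=\|u_0\|_1+\|f\|_{L^\infty(0,T;L^2(\Omega))}$. Let $u$ be the solution of the Kirchhoff problem and suppose that, as a function of $t$, $u$ is continuous on $[0,T]$, twice continuously differentiable on $(0,T]$, and satisfies $\left|\frac{\partial^lu}{\partial t^l}(t)\right|\le C_0(1+t^{\alpha-l})$ for $l=0,1,2$ and $t\in(0,T]$, for some constant $C_0$. Let $t_n=T(n/N)^\delta$ ($0\le n\le N$, $\delta\ge1$), $\tau_n=t_n-t_{n-1}$, $u^n=u(t_n)$, and for $n\in\{2,\dots,N\}$ $$\tilde u^{n-1}=\left(1+\frac{\tau_n}{\tau_{n-1}}\right)u^{n-1}-\frac{\tau_n}{\tau_{n-1}}u^{n-2}.$$ Then the linearization error $\mathbb{L}^n:=u^n-\tilde u^{n-1}$ satisfies, with a constant $C>0$ independent of $n$ and $N$, $$|\mathbb{L}^n|=|u^n-\tilde u^{n-1}|\le C\,N^{-\min\{\delta\alpha,\,2\}}\qquad\text{for all }n\in\{2,\dots,N\}.$$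
   Context: Let $\Omega\subset\mathbb{R}^d$ ($d\ge1$) be a bounded convex domain with smooth boundary, $T>0$, $\alpha\in(0,1)$. $(\cdot,\cdot)$ and $\|\cdot\|$ are the inner product and norm of $L^2(\Omega)$; $\|\cdot\|_m$ is the norm of $H^m(\Omega)$. Caputo derivative: ${}^{C}D^\alpha_t u=\frac{1}{\Gamma(1-\alpha)}\int_0^t(t-s)^{-\alpha}\frac{\partial u}{\partial s}(s)\,ds$. Data: $M:(0,\infty)\to\mathbb{R}$ is Lipschitz continuous with Lipschitz constant $L_M$ (its value at $0$ is its limit there); $u_0$ and $f$ are given; $b_2(x,t,s)\in\mathbb{R}^{d\times d}$ (symmetric positive definite), $b_1(x,t,s)\in\mathbb{R}^d$, $b_0(x,t,s)\in\mathbb{R}$ are smooth on $\bar\Omega\times[0,T]\times[0,T]$. For $w,v\in H^1_0(\Omega)$ put $B(t,s,w,v)=(b_2(\cdot,t,s)\nabla w,\nabla v)-(b_1(\cdot,t,s)w,\nabla v)+(b_0(\cdot,t,s)w,v)$. Kirchhoff problem: ${}^{C}D^\alpha_tu-M\big(\int_\Omega|\nabla u|^2dx\big)\Delta u=f+\int_0^tb(x,t,s)u(s)\,ds$ in $\Omega\times(0,T]$, with $b(x,t,s)u=-\nabla\cdot(b_2\nabla u)+\nabla\cdot(b_1u)+b_0u$, $u(\cdot,0)=u_0$, $u=0$ on $\partial\Omega\times[0,T]$. Its solution is the unique weak solution: $u\in L^2(0,T;H^2(\Omega)\cap H^1_0(\Omega))$, ${}^{C}D^\alpha_tu\in L^2(0,T;L^2(\Omega))$,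 $u(0)=u_0$ and $({}^{C}D^\alpha_tu,v)+M(\|\nabla u\|^2)(\nabla u,\nabla v)=(f,v)+\int_0^tB(t,s,u(s),v)\,ds$ for all $v\in H^1_0(\Omega)$, a.e. $t\in(0,T)$. The space variable is suppressed: $u(t)$ means $u(x,t)$ at a fixed $x\in\Omega$, $|\cdot|$ is the absolute value, and the constants $C_0$ and $C$ do not depend on $x$. The constant $C$ may depend on $T,\alpha,\delta,C_0$ and the given data. *)

theory Defs
  imports "HOL-Analysis.Analysis" "HOL-Probability.Essential_Supremum"
begin

section \<open>Smooth functions and smooth bounded convex domains\<close>

text \<open>\<open>ck_on k f U\<close>, for open \<open>U\<close>: \<open>f\<close> has continuous iterated directional derivatives up to
  order \<open>k\<close> on \<open>U\<close>.\<close>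

primrec ck_on :: "nat \<Rightarrow> ('a::euclidean_space \<Rightarrow> 'b::euclidean_space) \<Rightarrow> 'a set \<Rightarrow> bool" where
  "ck_on 0 f U \<longleftrightarrow> continuous_on U f"
| "ck_on (Suc k) f U \<longleftrightarrow>
     (\<exists>f'. (\<forall>x\<in>U. (f has_derivative f' x) (at x)) \<and> (\<forall>v. ck_on k (\<lambda>x. f' x v) U))"

text \<open>On a set that need not be open, smoothness means being the restriction of a function that
  is smooth on an open neighbourhood.\<close>

definition smooth_on :: "'a::euclidean_space set \<Rightarrow> ('a \<Rightarrow> 'b::euclidean_space) \<Rightarrow> bool" where
  "smooth_on S f \<longleftrightarrow> (\<exists>U g. open U \<and> S \<subseteq> U \<and> (\<forall>k. ck_on k g U) \<and> (\<forall>x\<in>S. g x = f x))"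

text \<open>After relabelling (\<open>i\<close>) and reorienting (\<open>\<sigma>\<close>) the coordinate axes, \<open>\<Omega>\<close> is near each
  boundary point the region above the graph of a smooth function \<open>\<gamma>\<close> of the other coordinates.\<close>

definition smooth_boundary :: "(real^'d) set \<Rightarrow> bool" where
  "smooth_boundary \<Omega> \<longleftrightarrow>
     (\<forall>p\<in>frontier \<Omega>. \<exists>r>0. \<exists>i. \<exists>\<sigma>\<in>{1, -1}. \<exists>\<gamma>::real^'d \<Rightarrow> real.
        smooth_on UNIV \<gamma> \<and>
        (\<forall>x y. (\<forall>j. j \<noteq> i \<longrightarrow> x $ j = y $ j) \<longrightarrow> \<gamma> x = \<gamma> y) \<and>
        \<Omega> \<inter> ball p r = {x \<in> ball p r. \<sigma> * x $ i > \<gamma> x})"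

definition smooth_convex_domain :: "(real^'d) set \<Rightarrow> bool" where
  "smooth_convex_domain \<Omega> \<longleftrightarrow>
     open \<Omega> \<and> \<Omega> \<noteq> {} \<and> bounded \<Omega> \<and> convex \<Omega> \<and> smooth_boundary \<Omega>"

definition test_functions :: "'a::euclidean_space set \<Rightarrow> ('a \<Rightarrow> real) set" where
  "test_functions \<Omega> =
     {\<phi>. smooth_on UNIV \<phi> \<and> compact (closure {x. \<phi> x \<noteq> 0}) \<and> closure {x. \<phi> x \<noteq> 0} \<subseteq> \<Omega>}"


section \<open>Lebesgue and Sobolev spaces on \<open>\<Omega>\<close>\<close>

text \<open>Elements of these spaces are represented by functions on the whole space, of which only the
  almost-everywhere class on \<open>\<Omega>\<close> matters.\<close>

definition L2 :: "'a::euclidean_space set \<Rightarrow> ('a \<Rightarrow> 'b::euclidean_space) set" where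
  "L2 \<Omega> = {f \<in> borel_measurable (lebesgue_on \<Omega>).
            integrable (lebesgue_on \<Omega>) (\<lambda>x. (norm (f x))\<^sup>2)}"

definition l2_inner ::
    "'a::euclidean_space set \<Rightarrow> ('a \<Rightarrow> 'b::euclidean_space) \<Rightarrow> ('a \<Rightarrow> 'b) \<Rightarrow> real" where
  "l2_inner \<Omega> f g = (LINT x|lebesgue_on \<Omega>. f x \<bullet> g x)"

definition l2_norm :: "'a::euclidean_space set \<Rightarrow> ('a \<Rightarrow> 'b::euclidean_space) \<Rightarrow> real" where
  "l2_norm \<Omega> f = sqrt (l2_inner \<Omega> f f)"

definition locally_integrable ::
    "'a::euclidean_space set \<Rightarrow> ('a \<Rightarrow> 'b::euclidean_space) \<Rightarrow> bool" where
  "locally_integrable \<Omega> f \<longleftrightarrow> (\<forall>K. compact K \<and> K \<subseteq> \<Omega> \<longrightarrow> integrable (lebesgue_on K) f)"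

definition has_weak_gradient ::
    "(real^'d) set \<Rightarrow> (real^'d \<Rightarrow> real) \<Rightarrow> (real^'d \<Rightarrow> real^'d) \<Rightarrow> bool" where
  "has_weak_gradient \<Omega> w g \<longleftrightarrow> locally_integrable \<Omega> w \<and> locally_integrable \<Omega> g \<and>
     (\<forall>\<phi>\<in>test_functions \<Omega>. \<forall>i.
        (LINT x|lebesgue_on \<Omega>. w x * frechet_derivative \<phi> (at x) (axis i 1)) =
        - (LINT x|lebesgue_on \<Omega>. g x $ i * \<phi> x))"

text \<open>The weak gradient is unique up to null sets; \<open>weak_gradient\<close> picks a representative.\<close>

definition weak_gradient ::
    "(real^'d) set \<Rightarrow> (real^'d \<Rightarrow> real) \<Rightarrow> real^'d \<Rightarrow> real^'d" where
  "weak_gradient \<Omega> w = (SOME g. has_weak_gradient \<Omega> w g)"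

definition H1 :: "(real^'d) set \<Rightarrow> (real^'d \<Rightarrow> real) set" where
  "H1 \<Omega> = {w \<in> L2 \<Omega>. \<exists>g\<in>L2 \<Omega>. has_weak_gradient \<Omega> w g}"

definition h1_norm :: "(real^'d) set \<Rightarrow> (real^'d \<Rightarrow> real) \<Rightarrow> real" where
  "h1_norm \<Omega> w = sqrt ((l2_norm \<Omega> w)\<^sup>2 + (l2_norm \<Omega> (weak_gradient \<Omega> w))\<^sup>2)"

definition H10 :: "(real^'d) set \<Rightarrow> (real^'d \<Rightarrow> real) set" where
  "H10 \<Omega> = {w \<in> H1 \<Omega>. \<exists>\<phi>::nat \<Rightarrow> real^'d \<Rightarrow> real.
      (\<forall>k. \<phi> k \<in> test_functions \<Omega>) \<and> (\<lambda>k. h1_norm \<Omega> (\<lambda>x. w x - \<phi> k x)) \<longlonglongrightarrow> 0}"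

definition H2 :: "(real^'d) set \<Rightarrow> (real^'d \<Rightarrow> real) set" where
  "H2 \<Omega> = {w \<in> H1 \<Omega>. \<forall>i. (\<lambda>x. weak_gradient \<Omega> w x $ i) \<in> H1 \<Omega>}"

text \<open>The second-order part is the \<open>L\<^sup>2\<close> norm of the full Hessian, so mixed derivatives are
  counted twice; the norm is equivalent to the one summing over multi-indices.\<close>

definition h2_norm :: "(real^'d) set \<Rightarrow> (real^'d \<Rightarrow> real) \<Rightarrow> real" where
  "h2_norm \<Omega> w = sqrt ((h1_norm \<Omega> w)\<^sup>2 +
     (\<Sum>i\<in>UNIV. (l2_norm \<Omega> (weak_gradient \<Omega> (\<lambda>x. weak_gradient \<Omega> w x $ i)))\<^sup>2))"


section \<open>Bochner spaces on \<open>(0,T)\<close>\<close>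

text \<open>A function space \<open>X\<close> with norm \<open>p\<close> is given by its carrier and the norm; strong
  measurability is almost-everywhere approximability by simple \<open>X\<close>-valued functions.\<close>

definition bochner_measurable ::
    "real \<Rightarrow> ('a \<Rightarrow> real) set \<Rightarrow> (('a \<Rightarrow> real) \<Rightarrow> real) \<Rightarrow> (real \<Rightarrow> 'a \<Rightarrow> real) \<Rightarrow> bool" where
  "bochner_measurable T X p u \<longleftrightarrow>
     (\<exists>s::nat \<Rightarrow> real \<Rightarrow> 'a \<Rightarrow> real.
        (\<forall>k. finite (s k ` {0<..<T}) \<and> s k ` {0<..<T} \<subseteq> X \<and>
             (\<forall>v. {t \<in> {0<..<T}. s k t = v} \<in> sets lebesgue)) \<and>
        (AE t in lebesgue_on {0<..<T}. (\<lambda>k. p (\<lambda>x. s k t x - u t x)) \<longlonglongrightarrow> 0))"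

text \<open>\<open>bochner_Lp q T X p\<close> is \<open>L\<^sup>q(0,T;X)\<close>.\<close>

definition bochner_Lp ::
    "nat \<Rightarrow> real \<Rightarrow> ('a \<Rightarrow> real) set \<Rightarrow> (('a \<Rightarrow> real) \<Rightarrow> real) \<Rightarrow> (real \<Rightarrow> 'a \<Rightarrow> real) set" where
  "bochner_Lp q T X p = {u. bochner_measurable T X p u \<and>
     (AE t in lebesgue_on {0<..<T}. u t \<in> X) \<and>
     integrable (lebesgue_on {0<..<T}) (\<lambda>t. (p (u t)) ^ q)}"

definition bochner_Linf ::
    "real \<Rightarrow> ('a \<Rightarrow> real) set \<Rightarrow> (('a \<Rightarrow> real) \<Rightarrow> real) \<Rightarrow> (real \<Rightarrow> 'a \<Rightarrow> real) set" where
  "bochner_Linf T X p = {u. bochner_measurable T X p u \<and>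
     (AE t in lebesgue_on {0<..<T}. u t \<in> X) \<and>
     (\<exists>c. AE t in lebesgue_on {0<..<T}. p (u t) \<le> c)}"

definition linf_norm ::
    "real \<Rightarrow> (('a \<Rightarrow> real) \<Rightarrow> real) \<Rightarrow> (real \<Rightarrow> 'a \<Rightarrow> real) \<Rightarrow> real" where
  "linf_norm T p u = real_of_ereal (esssup (lebesgue_on {0<..<T}) (\<lambda>t. ereal (p (u t))))"


section \<open>The Kirchhoff problem\<close>

text \<open>Weak time derivative in \<open>L\<^sup>1(0,T;L\<^sup>2(\<Omega>))\<close>. The identity
  \<open>\<integral> \<psi>'(t) u(t) dt = - \<integral> \<psi>(t) u'(t) dt\<close> between elements of \<open>L\<^sup>2(\<Omega>)\<close> is expressed by testing
  with every \<open>v\<close> in \<open>L\<^sup>2(\<Omega>)\<close>. It depends only on the classes of \<open>u\<close> and \<open>u'\<close>.\<close>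

definition has_weak_time_derivative ::
    "real \<Rightarrow> (real^'d) set \<Rightarrow> (real \<Rightarrow> real^'d \<Rightarrow> real) \<Rightarrow> (real \<Rightarrow> real^'d \<Rightarrow> real) \<Rightarrow> bool" where
  "has_weak_time_derivative T \<Omega> u u' \<longleftrightarrow>
     u \<in> bochner_Lp 1 T (L2 \<Omega>) (l2_norm \<Omega>) \<and>
     u' \<in> bochner_Lp 1 T (L2 \<Omega>) (l2_norm \<Omega>) \<and>
     (\<forall>\<psi>\<in>test_functions {0<..<T}. \<forall>v\<in>L2 \<Omega>.
        (LINT t|lebesgue_on {0<..<T}. deriv \<psi> t * l2_inner \<Omega> (u t) v) =
        - (LINT t|lebesgue_on {0<..<T}. \<psi> t * l2_inner \<Omega> (u' t) v))"

text \<open>\<open>w(t) = 1 / \<Gamma>(1 - \<alpha>) \<integral>\<^sub>0\<^sup>t (t - s)\<^sup>-\<^sup>\<alpha> \<partial>\<^sub>su(s) ds\<close> in \<open>L\<^sup>2(\<Omega>)\<close>, again tested with \<open>v\<close>.\<close>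

definition has_caputo_derivative ::
    "real \<Rightarrow> real \<Rightarrow> (real^'d) set \<Rightarrow> (real \<Rightarrow> real^'d \<Rightarrow> real) \<Rightarrow> (real \<Rightarrow> real^'d \<Rightarrow> real) \<Rightarrow> bool"
  where
  "has_caputo_derivative \<alpha> T \<Omega> u w \<longleftrightarrow>
     (\<exists>u'. has_weak_time_derivative T \<Omega> u u' \<and>
       (\<forall>v\<in>L2 \<Omega>. AE t in lebesgue_on {0<..<T}.
          l2_inner \<Omega> (w t) v =
          1 / Gamma (1 - \<alpha>) *
            (LINT s|lebesgue_on {0..t}. (t - s) powr (- \<alpha>) * l2_inner \<Omega> (u' s) v)))"

definition memory_form ::
    "(real^'d) set \<Rightarrow> (real^'d \<Rightarrow> real \<Rightarrow> real \<Rightarrow> real^'d^'d) \<Rightarrow>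
     (real^'d \<Rightarrow> real \<Rightarrow> real \<Rightarrow> real^'d) \<Rightarrow> (real^'d \<Rightarrow> real \<Rightarrow> real \<Rightarrow> real) \<Rightarrow>
     real \<Rightarrow> real \<Rightarrow> (real^'d \<Rightarrow> real) \<Rightarrow> (real^'d \<Rightarrow> real) \<Rightarrow> real" where
  "memory_form \<Omega> b2 b1 b0 t s w v =
     l2_inner \<Omega> (\<lambda>x. b2 x t s *v weak_gradient \<Omega> w x) (weak_gradient \<Omega> v)
     - l2_inner \<Omega> (\<lambda>x. w x *\<^sub>R b1 x t s) (weak_gradient \<Omega> v)
     + l2_inner \<Omega> (\<lambda>x. b0 x t s * w x) v"

definition memory_coefficients ::
    "real \<Rightarrow> (real^'d) set \<Rightarrow> (real^'d \<Rightarrow> real \<Rightarrow> real \<Rightarrow> real^'d^'d) \<Rightarrow>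
     (real^'d \<Rightarrow> real \<Rightarrow> real \<Rightarrow> real^'d) \<Rightarrow> (real^'d \<Rightarrow> real \<Rightarrow> real \<Rightarrow> real) \<Rightarrow> bool" where
  "memory_coefficients T \<Omega> b2 b1 b0 \<longleftrightarrow>
     smooth_on (closure \<Omega> \<times> {0..T} \<times> {0..T}) (\<lambda>(x, t, s). b2 x t s) \<and>
     smooth_on (closure \<Omega> \<times> {0..T} \<times> {0..T}) (\<lambda>(x, t, s). b1 x t s) \<and>
     smooth_on (closure \<Omega> \<times> {0..T} \<times> {0..T}) (\<lambda>(x, t, s). b0 x t s) \<and>
     (\<forall>x\<in>closure \<Omega>. \<forall>t\<in>{0..T}. \<forall>s\<in>{0..T}.
        transpose (b2 x t s) = b2 x t s \<and> (\<forall>\<xi>. \<xi> \<noteq> 0 \<longrightarrow> \<xi> \<bullet> (b2 x t s *v \<xi>) > 0))"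

text \<open>The initial condition concerns the value at \<open>t = 0\<close> of the representative that is continuous
  at \<open>0\<close> in \<open>L\<^sup>2(\<Omega>)\<close>; the limit ties it to the values at positive times.\<close>

definition is_weak_solution ::
    "real \<Rightarrow> real \<Rightarrow> (real^'d) set \<Rightarrow> (real \<Rightarrow> real) \<Rightarrow>
     (real^'d \<Rightarrow> real \<Rightarrow> real \<Rightarrow> real^'d^'d) \<Rightarrow> (real^'d \<Rightarrow> real \<Rightarrow> real \<Rightarrow> real^'d) \<Rightarrow>
     (real^'d \<Rightarrow> real \<Rightarrow> real \<Rightarrow> real) \<Rightarrow> (real^'d \<Rightarrow> real) \<Rightarrow> (real \<Rightarrow> real^'d \<Rightarrow> real) \<Rightarrow>
     (real \<Rightarrow> real^'d \<Rightarrow> real) \<Rightarrow> bool" where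
  "is_weak_solution \<alpha> T \<Omega> M b2 b1 b0 u0 f u \<longleftrightarrow>
     u \<in> bochner_Lp 2 T (H2 \<Omega> \<inter> H10 \<Omega>) (h2_norm \<Omega>) \<and>
     (AE x in lebesgue_on \<Omega>. u 0 x = u0 x) \<and>
     ((\<lambda>t. l2_norm \<Omega> (\<lambda>x. u t x - u0 x)) \<longlongrightarrow> 0) (at_right 0) \<and>
     (\<exists>w. has_caputo_derivative \<alpha> T \<Omega> u w \<and>
        w \<in> bochner_Lp 2 T (L2 \<Omega>) (l2_norm \<Omega>) \<and>
        (\<forall>v\<in>H10 \<Omega>. AE t in lebesgue_on {0<..<T}.
           l2_inner \<Omega> (w t) v
           + M ((l2_norm \<Omega> (weak_gradient \<Omega> (u t)))\<^sup>2)
               * l2_inner \<Omega> (weak_gradient \<Omega> (u t)) (weak_gradient \<Omega> v) =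
           l2_inner \<Omega> (f t) v
           + (LINT s|lebesgue_on {0..t}. memory_form \<Omega> b2 b1 b0 t s (u s) v)))"

text \<open>For \<open>y = u(x,\<cdot>)\<close> at a fixed \<open>x\<close>. The derivatives are taken within \<open>(0,T]\<close>, i.e. one-sided
  at \<open>T\<close>.\<close>

definition time_regular :: "real \<Rightarrow> real \<Rightarrow> real \<Rightarrow> (real \<Rightarrow> real) \<Rightarrow> bool" where
  "time_regular T \<alpha> C0 y \<longleftrightarrow> continuous_on {0..T} y \<and>
     (\<exists>y1 y2. (\<forall>t\<in>{0<..T}. (y has_real_derivative y1 t) (at t within {0<..T})) \<and>
        (\<forall>t\<in>{0<..T}. (y1 has_real_derivative y2 t) (at t within {0<..T})) \<and>
        continuous_on {0<..T} y2 \<and>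
        (\<forall>t\<in>{0<..T}. \<bar>y t\<bar> \<le> C0 * (1 + t powr \<alpha>) \<and>
           \<bar>y1 t\<bar> \<le> C0 * (1 + t powr (\<alpha> - 1)) \<and>
           \<bar>y2 t\<bar> \<le> C0 * (1 + t powr (\<alpha> - 2))))"


section \<open>Graded mesh and linearization\<close>

definition mesh :: "real \<Rightarrow> real \<Rightarrow> nat \<Rightarrow> nat \<Rightarrow> real" where
  "mesh T \<delta> N n = T * (real n / real N) powr \<delta>"

definition mesh_step :: "real \<Rightarrow> real \<Rightarrow> nat \<Rightarrow> nat \<Rightarrow> real" where
  "mesh_step T \<delta> N n = mesh T \<delta> N n - mesh T \<delta> N (n - 1)"

text \<open>\<open>extrapolation T \<delta> N y n\<close> is the value written with superscript \<open>n - 1\<close> and a tilde; it is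
  meant for \<open>n \<ge> 2\<close>.\<close>

definition extrapolation :: "real \<Rightarrow> real \<Rightarrow> nat \<Rightarrow> (real \<Rightarrow> real) \<Rightarrow> nat \<Rightarrow> real" where
  "extrapolation T \<delta> N y n =
     (let \<rho> = mesh_step T \<delta> N n / mesh_step T \<delta> N (n - 1)
      in (1 + \<rho>) * y (mesh T \<delta> N (n - 1)) - \<rho> * y (mesh T \<delta> N (n - 2)))"

definition linearization_error :: "real \<Rightarrow> real \<Rightarrow> nat \<Rightarrow> (real \<Rightarrow> real) \<Rightarrow> nat \<Rightarrow> real" where
  "linearization_error T \<delta> N y n = y (mesh T \<delta> N n) - extrapolation T \<delta> N y n"

end

theory Submission
  imports Defs
begin

text \<open>For \<open>n \<ge> 3\<close> the error is
  \<open>\<tau>\<^sub>n\<close> times a difference of two values of \<open>\<partial>\<^sub>tu\<close>, hence at most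
  \<open>\<tau>\<^sub>n (\<tau>\<^sub>n + \<tau>\<^bsub>n-1\<^esub>) sup \<bar>\<partial>\<^sub>t\<^sup>2u\<bar>\<close> over \<open>[t\<^bsub>n-2\<^esub>, t\<^sub>n]\<close>; on the graded mesh
  \<open>\<tau>\<^sub>n \<le> \<delta> T (n/N)\<^bsup>\<delta>-1\<^esup>/N\<close> and \<open>t\<^bsub>n-2\<^esub> \<ge> T (n/(3N))\<^sup>\<delta>\<close>. For \<open>n = 2\<close> the second derivative is
  useless because \<open>t\<^sub>0 = 0\<close>, but \<open>\<bar>u(t) - u(0)\<bar> = O(t + t\<^sup>\<alpha>)\<close> and \<open>t\<^sub>2\<close> is of order \<open>N\<^bsup>-\<delta>\<^esup>\<close>.\<close>

section \<open>Estimates for a single function of time\<close>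

lemma time_regular_const_nonneg:
  assumes "time_regular T \<alpha> C0 y" "T > 0"
  shows "C0 \<ge> 0"
proof -
  have "0 \<le> \<bar>y T\<bar>" by simp
  also have "\<dots> \<le> C0 * (1 + T powr \<alpha>)"
    using assms by (auto simp: time_regular_def)
  finally show ?thesis
    using powr_ge_zero[of T \<alpha>] by (simp add: zero_le_mult_iff)
qed

text \<open>The bound on the first derivative is singular at 0 but integrable, with primitive
  \<open>?g\<close>. Since \<open>y\<close> is only continuous at 0, no integral is formed:
  \<open>?g - y\<close> and \<open>?g + y\<close> have nonnegative derivatives on the open interval
  and are continuous up to its ends, so both are nondecreasing.\<close>

lemma time_regular_increment_from_0:
  assumes "time_regular T \<alpha> C0 y" "0 < \<alpha>" "0 < t" "t \<le> T"
  shows "\<bar>y t - y 0\<bar> \<le> C0 * (t + t powr \<alpha> / \<alpha>)"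
proof -
  obtain y1 y2 where
    y1: "\<And>s. s \<in> {0<..T} \<Longrightarrow> (y has_real_derivative y1 s) (at s within {0<..T})"
    and bnd: "\<And>s. s \<in> {0<..T} \<Longrightarrow> \<bar>y1 s\<bar> \<le> C0 * (1 + s powr (\<alpha> - 1))"
    using assms(1) unfolding time_regular_def by blast
  have cont: "continuous_on {0..t} y"
    using assms(1,4) unfolding time_regular_def by (auto intro: continuous_on_subset)
  let ?g = "\<lambda>s. C0 * (s + s powr \<alpha> / \<alpha>)"
  have contg: "continuous_on {0..t} ?g"
    using assms(2) by (auto intro!: continuous_intros continuous_on_powr')
  have derg: "(?g has_real_derivative C0 * (1 + s powr (\<alpha> - 1))) (at s)" if "0 < s" for s
    using that assms(2) by (auto intro!: derivative_eq_intros simp: field_simps)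
  have dery: "(y has_real_derivative y1 s) (at s)" if "0 < s" "s < t" for s
  proof -
    have "(y has_real_derivative y1 s) (at s within {0<..<t})"
      using y1[of s] that assms(4) by (auto intro: DERIV_subset)
    then show ?thesis using that by (simp add: at_within_open[of s "{0<..<t}"])
  qed
  have "?g 0 - y 0 \<le> ?g t - y t"
  proof (rule DERIV_nonneg_imp_increasing_open[of 0 t "\<lambda>s. ?g s - y s"])
    show "\<exists>z. ((\<lambda>s. ?g s - y s) has_real_derivative z) (at s) \<and> 0 \<le> z"
      if "0 < s" "s < t" for s
      using DERIV_diff[OF derg dery] bnd[of s] that assms(4) by force
  qed (use assms cont contg in \<open>auto intro!: continuous_on_diff\<close>)
  moreover have "?g 0 + y 0 \<le> ?g t + y t"
  proof (rule DERIV_nonneg_imp_increasing_open[of 0 t "\<lambda>s. ?g s + y s"])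
    show "\<exists>z. ((\<lambda>s. ?g s + y s) has_real_derivative z) (at s) \<and> 0 \<le> z"
      if "0 < s" "s < t" for s
      using DERIV_add[OF derg dery] bnd[of s] that assms(4) by force
  qed (use assms cont contg in \<open>auto intro!: continuous_on_add\<close>)
  ultimately show ?thesis by simp
qed

text \<open>The mean value theorem is used three times: for the slopes of \<open>y\<close> over
  [b,c] and over [a,b], and then for \<open>y1\<close> between the two intermediate points, whose
  distance is at most c - a.\<close>

lemma linear_extrapolation_error:
  fixes y y1 y2 :: "real \<Rightarrow> real"
  assumes "a < b" "b < c"
    and y1: "\<And>t. t \<in> {a..c} \<Longrightarrow> (y has_real_derivative y1 t) (at t within {a..c})"
    and y2: "\<And>t. t \<in> {a..c} \<Longrightarrow> (y1 has_real_derivative y2 t) (at t within {a..c})"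
    and bnd: "\<And>t. t \<in> {a..c} \<Longrightarrow> \<bar>y2 t\<bar> \<le> D"
    and \<rho>: "\<rho> = (c - b) / (b - a)"
  shows "\<bar>y c - ((1 + \<rho>) * y b - \<rho> * y a)\<bar> \<le> D * ((c - b) * (c - a))"
proof -
  have mvt: "\<exists>\<xi>\<in>{p<..<q}. g q - g p = (q - p) * g' \<xi>"
    if pq: "p < q" and sub: "{p..q} \<subseteq> {a..c}"
      and der: "\<And>t. t \<in> {a..c} \<Longrightarrow> (g has_real_derivative g' t) (at t within {a..c})"
    for p q g g'
  proof -
    have "\<exists>\<xi>\<in>{p<..<q}. g q - g p = (*) (g' \<xi>) (q - p)"
    proof (rule mvt_simple[OF pq])
      show "(g has_derivative (*) (g' t)) (at t within {p..q})" if "p \<le> t" "t \<le> q" for t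
        using DERIV_subset[OF der sub] that sub by (auto simp: has_field_derivative_def)
    qed
    then show ?thesis by (simp add: mult.commute)
  qed
  obtain \<xi> where \<xi>: "\<xi> \<in> {b<..<c}" "y c - y b = (c - b) * y1 \<xi>"
    using mvt[of b c y y1] y1 assms(1,2) by force
  obtain \<eta> where \<eta>: "\<eta> \<in> {a<..<b}" "y b - y a = (b - a) * y1 \<eta>"
    using mvt[of a b y y1] y1 assms(1,2) by force
  obtain \<zeta> where \<zeta>: "\<zeta> \<in> {\<eta><..<\<xi>}" "y1 \<xi> - y1 \<eta> = (\<xi> - \<eta>) * y2 \<zeta>"
    using mvt[of \<eta> \<xi> y1 y2] y2 \<xi>(1) \<eta>(1) by force
  have "y c - ((1 + \<rho>) * y b - \<rho> * y a) = (y c - y b) - \<rho> * (y b - y a)"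
    by (simp add: algebra_simps)
  \<comment> \<open>The weight \<open>\<rho>\<close> turns the step b - a into c - b, so both slopes
    carry the same factor.\<close>
  also have "\<dots> = (c - b) * (y1 \<xi> - y1 \<eta>)"
    using assms(1) by (simp add: \<xi>(2) \<eta>(2) \<rho> right_diff_distrib)
  finally have eq: "y c - ((1 + \<rho>) * y b - \<rho> * y a) = y2 \<zeta> * ((c - b) * (\<xi> - \<eta>))"
    using \<zeta>(2) by simp
  have "\<bar>y2 \<zeta>\<bar> * ((c - b) * (\<xi> - \<eta>)) \<le> D * ((c - b) * (c - a))"
    using \<xi>(1) \<eta>(1) \<zeta>(1) assms(1,2) bnd[of \<zeta>] order_trans[OF abs_ge_zero bnd[of \<zeta>]]
    by (intro mult_mono) auto
  then show ?thesis
    using \<xi>(1) \<eta>(1) assms(2) by (simp add: eq abs_mult)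
qed

section \<open>Step sizes and powers on the graded mesh\<close>

text \<open>The mean value theorem needs differentiability only inside the interval, so q = 0, the
  case of the first mesh step, is covered. As the exponent \<open>\<delta> - 1\<close> is
  nonnegative, the intermediate point may be replaced by p.\<close>

lemma powr_diff_le:
  fixes p q \<delta> :: real
  assumes "0 \<le> q" "q < p" "\<delta> \<ge> 1"
  shows "p powr \<delta> - q powr \<delta> \<le> \<delta> * p powr (\<delta> - 1) * (p - q)"
proof -
  have "continuous_on {q..p} (\<lambda>s. s powr \<delta>)"
    using assms by (auto intro!: continuous_intros continuous_on_powr')
  moreover have "((\<lambda>s. s powr \<delta>) has_derivative (*) (\<delta> * s powr (\<delta> - 1))) (at s)"
    if "q < s" "s < p" for s
    unfolding has_field_derivative_def[symmetric]
    using that assms(1) by (auto intro!: derivative_eq_intros)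
  ultimately obtain \<xi> where "q < \<xi>" "\<xi> < p"
    "p powr \<delta> - q powr \<delta> = \<delta> * \<xi> powr (\<delta> - 1) * (p - q)"
    using mvt[OF assms(2), of "\<lambda>s. s powr \<delta>" "\<lambda>s. (*) (\<delta> * s powr (\<delta> - 1))"] by blast
  then show ?thesis
    using assms by (auto intro!: mult_right_mono mult_left_mono powr_mono2)
qed

lemma mesh_strict_mono:
  assumes "T > 0" "\<delta> > 0" "m < n" "N > 0"
  shows "mesh T \<delta> N m < mesh T \<delta> N n"
  using assms by (auto simp: mesh_def intro!: powr_less_mono2 divide_strict_right_mono)

lemma mesh_le:
  assumes "T > 0" "\<delta> > 0" "n \<le> N" "N > 0"
  shows "mesh T \<delta> N n \<le> T"
proof -
  have "(real n / real N) powr \<delta> \<le> 1"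
    using assms by (intro powr_le1) auto
  then show ?thesis using assms by (simp add: mesh_def)
qed

text \<open>The second index n lets two consecutive steps share one bound.\<close>

lemma mesh_step_le:
  assumes "T > 0" "\<delta> \<ge> 1" "1 \<le> m" "m \<le> n" "N > 0"
  shows "mesh_step T \<delta> N m \<le> T * \<delta> * (real n / real N) powr (\<delta> - 1) / real N"
proof -
  have "(real m / real N) powr \<delta> - (real (m - 1) / real N) powr \<delta>
      \<le> \<delta> * (real m / real N) powr (\<delta> - 1) * (real m / real N - real (m - 1) / real N)"
    using assms by (intro powr_diff_le) (auto intro!: divide_strict_right_mono)
  also have "real m / real N - real (m - 1) / real N = 1 / real N"
    using assms by (simp add: diff_divide_distrib [symmetric] of_nat_diff)
  also have "\<delta> * (real m / real N) powr (\<delta> - 1) * (1 / real N)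
      \<le> \<delta> * (real n / real N) powr (\<delta> - 1) * (1 / real N)"
    using assms by (intro mult_right_mono mult_left_mono powr_mono2 divide_right_mono) auto
  finally have "T * ((real m / real N) powr \<delta> - (real (m - 1) / real N) powr \<delta>)
      \<le> T * (\<delta> * (real n / real N) powr (\<delta> - 1) * (1 / real N))"
    using assms(1) by (intro mult_left_mono) auto
  then show ?thesis
    by (simp add: mesh_step_def mesh_def algebra_simps)
qed

text \<open>Here the minimum in the rate arises, with r = n/N and
  \<open>\<beta> = \<delta> * \<alpha>\<close>. If \<open>\<beta>\<close> is at least 2, the power
  of r is at most 1 and the inverse square of N remains. Otherwise that power is largest at the
  smallest admissible r = 1/N, where it cancels all but the order \<open>\<beta>\<close>.\<close>

lemma powr_div_square_le:
  fixes N r \<beta> :: real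
  assumes "N \<ge> 1" "1 / N \<le> r" "r \<le> 1"
  shows "r powr (\<beta> - 2) / N\<^sup>2 \<le> N powr (- min \<beta> 2)"
proof (cases "\<beta> \<ge> 2")
  case True
  have "0 \<le> r" using assms by (auto intro: order_trans[of 0 "1 / N"])
  then have "r powr (\<beta> - 2) \<le> 1"
    using True assms by (intro powr_le1) auto
  then show ?thesis
    using True assms by (simp add: powr_minus_divide divide_right_mono)
next
  case False
  have "r powr (\<beta> - 2) \<le> (1 / N) powr (\<beta> - 2)"
    using False assms by (intro powr_mono2') auto
  also have "\<dots> = N powr (2 - \<beta>)"
    using assms by (simp add: powr_divide powr_minus_divide[symmetric])
  also have "\<dots> = N powr - \<beta> * N\<^sup>2"
    using assms powr_add[of N "- \<beta>" 2] by simp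
  finally show ?thesis
    using False assms by (simp add: divide_le_eq min_def)
qed

section \<open>The error at n = 2 and at n >= 3\<close>

lemma linearization_error_second_le:
  assumes reg: "time_regular T \<alpha> C0 y"
    and "T > 0" "0 < \<alpha>" "\<alpha> < 1" "\<delta> \<ge> 1" "N \<ge> 2"
  shows "\<bar>linearization_error T \<delta> N y 2\<bar>
    \<le> (1 + 2 powr \<delta>) * C0 * (T * 2 powr \<delta> + (T * 2 powr \<delta>) powr \<alpha> / \<alpha>)
        * real N powr (- min (\<delta> * \<alpha>) 2)"
proof -
  let ?m = "mesh T \<delta> N" and ?e = "real N powr (- min (\<delta> * \<alpha>) 2)"
  have C0: "C0 \<ge> 0" using time_regular_const_nonneg[OF reg \<open>T > 0\<close>] .
  have m0: "?m 0 = 0" using assms by (simp add: mesh_def)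
  have m2: "?m 2 = T * 2 powr \<delta> * real N powr - \<delta>"
    using assms by (simp add: mesh_def powr_divide powr_minus_divide)
  have m12: "0 < ?m 1" "?m 1 < ?m 2" "?m 2 \<le> T"
    using mesh_strict_mono[of T \<delta> 0 1 N] mesh_strict_mono[of T \<delta> 1 2 N] mesh_le[of T \<delta> 2 N]
      assms m0 by auto
  have m21: "?m 2 = 2 powr \<delta> * ?m 1"
    using assms by (simp add: mesh_def powr_divide)
  define \<rho> where "\<rho> = mesh_step T \<delta> N 2 / mesh_step T \<delta> N 1"
  have "\<rho> = (2 powr \<delta> * ?m 1 - ?m 1) / ?m 1"
    by (simp add: \<rho>_def mesh_step_def m0 m21)
  then have "(1 + \<rho>) * ?m 1 = 2 powr \<delta> * ?m 1"
    using m12(1) by (simp add: field_simps)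
  \<comment> \<open>The ratio of the first two steps depends on the grading alone, not on N.\<close>
  then have \<rho>: "1 + \<rho> = 2 powr \<delta>"
    using m12(1) by simp
  have e: "real N powr - (\<delta> * \<alpha>) \<le> ?e"
    using assms by (intro powr_mono) auto
  \<comment> \<open>As \<open>\<alpha>\<close> is below 1, the linear part of the increment bound
    decays at least as fast as the singular part.\<close>
  have "\<delta> * \<alpha> \<le> \<delta>" using assms by (simp add: mult_left_le)
  then have e': "real N powr - \<delta> \<le> ?e"
    using assms by (intro powr_mono) (auto simp: min.coboundedI1)
  define g where "g = (\<lambda>t. t + t powr \<alpha> / \<alpha>)"
  have "g (?m 2) = T * 2 powr \<delta> * real N powr - \<delta>
      + (T * 2 powr \<delta>) powr \<alpha> / \<alpha> * real N powr - (\<delta> * \<alpha>)"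
    using assms by (simp add: g_def m2 powr_mult powr_powr)
  also have "\<dots> \<le> T * 2 powr \<delta> * ?e + (T * 2 powr \<delta>) powr \<alpha> / \<alpha> * ?e"
    using assms e e' by (intro add_mono mult_left_mono) auto
  finally have g2: "g (?m 2) \<le> (T * 2 powr \<delta> + (T * 2 powr \<delta>) powr \<alpha> / \<alpha>) * ?e"
    by (simp add: distrib_right)
  have g1: "g (?m 1) \<le> g (?m 2)"
    unfolding g_def using m12 assms
    by (intro add_mono divide_right_mono powr_mono2) auto
  have inc: "\<bar>y (?m 2) - y 0\<bar> \<le> C0 * g (?m 2)" "\<bar>y (?m 1) - y 0\<bar> \<le> C0 * g (?m 1)"
    unfolding g_def using time_regular_increment_from_0[OF reg \<open>0 < \<alpha>\<close>] m12 by auto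
  \<comment> \<open>The coefficients of the three values of \<open>y\<close> sum to zero, so
    \<open>y 0\<close> can be subtracted from each of them.\<close>
  have "linearization_error T \<delta> N y 2 = (y (?m 2) - y 0) - (1 + \<rho>) * (y (?m 1) - y 0)"
    by (simp add: linearization_error_def extrapolation_def Let_def \<rho>_def m0 algebra_simps
        diff_divide_distrib)
  also have "\<bar>\<dots>\<bar> \<le> \<bar>y (?m 2) - y 0\<bar> + 2 powr \<delta> * \<bar>y (?m 1) - y 0\<bar>"
    unfolding \<rho> by (rule order_trans[OF abs_triangle_ineq4]) (simp add: abs_mult)
  also have "\<dots> \<le> C0 * g (?m 2) + 2 powr \<delta> * (C0 * g (?m 2))"
    using inc mult_left_mono[OF g1 C0] by (intro add_mono mult_left_mono) auto
  also have "\<dots> = (1 + 2 powr \<delta>) * C0 * g (?m 2)"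
    by (simp add: algebra_simps)
  also have "\<dots> \<le> (1 + 2 powr \<delta>) * C0 * ((T * 2 powr \<delta> + (T * 2 powr \<delta>) powr \<alpha> / \<alpha>) * ?e)"
    using g2 C0 by (intro mult_left_mono) auto
  finally show ?thesis by (simp add: mult.assoc)
qed

text \<open>From n = 3 on, the left node \<open>a\<close> is positive and comparable to the right
  node \<open>c\<close>, so the second derivative is controlled on all of [a,c]. In the constant, 2
  comes from c - a <= 2h, the square from the two factors h, and the power of
  \<open>T / 3 powr \<delta>\<close> from the lower bound on \<open>a\<close>.\<close>

lemma linearization_error_later_le:
  assumes reg: "time_regular T \<alpha> C0 y"
    and "T > 0" "\<alpha> < 1" "\<delta> \<ge> 1" and n: "3 \<le> n" "n \<le> N"
  shows "\<bar>linearization_error T \<delta> N y n\<bar>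
    \<le> 2 * C0 * (T * \<delta>)\<^sup>2 * (1 + (T / 3 powr \<delta>) powr (\<alpha> - 2))
        * real N powr (- min (\<delta> * \<alpha>) 2)"
proof -
  define a b c where "a = mesh T \<delta> N (n - 2)" and "b = mesh T \<delta> N (n - 1)"
    and "c = mesh T \<delta> N n"
  define r where "r = real n / real N"
  define h where "h = T * \<delta> * r powr (\<delta> - 1) / real N"
  let ?e = "real N powr (- min (\<delta> * \<alpha>) 2)" and ?\<gamma> = "(T / 3 powr \<delta>) powr (\<alpha> - 2)"
  have C0: "C0 \<ge> 0" using time_regular_const_nonneg[OF reg \<open>T > 0\<close>] .
  have r: "0 < r" "1 / real N \<le> r" "r \<le> 1"
    using n by (auto simp: r_def divide_right_mono)
  have abc: "a < b" "b < c" "c \<le> T" "0 < a"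
    using mesh_strict_mono[of T \<delta> "n - 2" "n - 1" N] mesh_strict_mono[of T \<delta> "n - 1" n N]
      mesh_le[of T \<delta> n N] assms by (auto simp: a_def b_def c_def mesh_def)
  have cb: "c - b \<le> h" and ba: "b - a \<le> h"
    using mesh_step_le[of T \<delta> n n N] mesh_step_le[of T \<delta> "n - 1" n N] assms
    by (auto simp: mesh_step_def a_def b_def c_def h_def r_def numeral_2_eq_2)
  have "T / 3 powr \<delta> * r powr \<delta> = T * (r / 3) powr \<delta>"
    using r by (simp add: powr_divide)
  also have "\<dots> \<le> a"
  proof -
    \<comment> \<open>n - 2 >= n/3 holds exactly when n >= 3; this is the source of the 3.\<close>
    have "r / 3 \<le> real (n - 2) / real N"
      using n by (simp add: r_def field_simps of_nat_diff)
    then show ?thesis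
      unfolding a_def mesh_def using assms r by (intro mult_left_mono powr_mono2) auto
  qed
  finally have "a powr (\<alpha> - 2) \<le> (T / 3 powr \<delta> * r powr \<delta>) powr (\<alpha> - 2)"
    using assms r by (intro powr_mono2') auto
  also have "\<dots> = ?\<gamma> * r powr (\<delta> * (\<alpha> - 2))"
    using assms by (subst powr_mult) (auto simp: powr_powr)
  finally have a: "a powr (\<alpha> - 2) \<le> ?\<gamma> * r powr (\<delta> * (\<alpha> - 2))" .
  obtain y1 y2 where
    y1: "\<And>t. t \<in> {0<..T} \<Longrightarrow> (y has_real_derivative y1 t) (at t within {0<..T})"
    and y2: "\<And>t. t \<in> {0<..T} \<Longrightarrow> (y1 has_real_derivative y2 t) (at t within {0<..T})"
    and bnd: "\<And>t. t \<in> {0<..T} \<Longrightarrow> \<bar>y2 t\<bar> \<le> C0 * (1 + t powr (\<alpha> - 2))"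
    using reg unfolding time_regular_def by blast
  have sub: "{a..c} \<subseteq> {0<..T}" using abc by auto
  define D where "D = C0 * (1 + ?\<gamma> * r powr (\<delta> * (\<alpha> - 2)))"
  have "D \<ge> 0" using C0 by (simp add: D_def)
  have err: "\<bar>linearization_error T \<delta> N y n\<bar> \<le> D * ((c - b) * (c - a))"
    unfolding linearization_error_def extrapolation_def Let_def a_def[symmetric]
      b_def[symmetric] c_def[symmetric]
  proof (rule linear_extrapolation_error[OF abc(1,2)])
    fix t assume t: "t \<in> {a..c}"
    show "(y has_real_derivative y1 t) (at t within {a..c})"
      "(y1 has_real_derivative y2 t) (at t within {a..c})"
      using y1 y2 t sub by (blast intro: DERIV_subset)+
    \<comment> \<open>The exponent is negative, so the left end of the interval is the worst
      point.\<close>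
    have "t powr (\<alpha> - 2) \<le> a powr (\<alpha> - 2)"
      using t abc assms by (intro powr_mono2') auto
    then have "1 + t powr (\<alpha> - 2) \<le> 1 + ?\<gamma> * r powr (\<delta> * (\<alpha> - 2))"
      using a by linarith
    then have "C0 * (1 + t powr (\<alpha> - 2)) \<le> D"
      using C0 unfolding D_def by (rule mult_left_mono)
    then show "\<bar>y2 t\<bar> \<le> D" using bnd[of t] t sub by force
  qed (auto simp: mesh_step_def a_def b_def c_def numeral_2_eq_2)
  \<comment> \<open>The two summands of \<open>D\<close> are treated apart: \<open>r1\<close> and
    \<open>e1\<close> serve the bounded one, \<open>e2\<close> the singular one.\<close>
  have r1: "r powr (2 * \<delta> - 2) \<le> 1"
    using r assms by (intro powr_le1) auto
  have e1: "1 / (real N)\<^sup>2 \<le> ?e"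
    using powr_div_square_le[of "real N" 1 "\<delta> * \<alpha>"] n by simp
  have e2: "r powr (\<delta> * \<alpha> - 2) / (real N)\<^sup>2 \<le> ?e"
    using powr_div_square_le[of "real N" r "\<delta> * \<alpha>"] n r by simp
  have h2: "h\<^sup>2 = (T * \<delta>)\<^sup>2 * (r powr (2 * \<delta> - 2) / (real N)\<^sup>2)"
    using r by (simp add: h_def power_divide power_mult_distrib powr_power algebra_simps)
  have "(c - b) * (c - a) \<le> h * (2 * h)"
    using cb ba abc by (intro mult_mono) auto
  then have "D * ((c - b) * (c - a)) \<le> D * (2 * h\<^sup>2)"
    using \<open>D \<ge> 0\<close> by (intro mult_left_mono) (auto simp: power2_eq_square)
  also have "\<dots> = 2 * C0 * (T * \<delta>)\<^sup>2 * (r powr (2 * \<delta> - 2) / (real N)\<^sup>2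
      + ?\<gamma> * (r powr (\<delta> * (\<alpha> - 2)) * r powr (2 * \<delta> - 2) / (real N)\<^sup>2))"
    by (simp add: D_def h2 algebra_simps add_divide_distrib)
  \<comment> \<open>The grading gained from the two steps offsets the singularity, which leaves the
    exponent required by \<open>e2\<close>.\<close>
  also have "r powr (\<delta> * (\<alpha> - 2)) * r powr (2 * \<delta> - 2) = r powr (\<delta> * \<alpha> - 2)"
    by (simp add: powr_add[symmetric] algebra_simps)
  also have "2 * C0 * (T * \<delta>)\<^sup>2 * (r powr (2 * \<delta> - 2) / (real N)\<^sup>2
      + ?\<gamma> * (r powr (\<delta> * \<alpha> - 2) / (real N)\<^sup>2)) \<le> 2 * C0 * (T * \<delta>)\<^sup>2 * (?e + ?\<gamma> * ?e)"
    using C0 e2 order_trans[OF divide_right_mono[OF r1] e1]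
    by (intro mult_left_mono add_mono) auto
  finally show ?thesis
    using err by (simp add: algebra_simps)
qed

theorem lemma4p11:
  fixes \<Omega> :: "(real^'d) set"
    and T \<alpha> \<delta> L_M m0 K C0 :: real
    and M :: "real \<Rightarrow> real"
    and b2 :: "real^'d \<Rightarrow> real \<Rightarrow> real \<Rightarrow> real^'d^'d"
    and b1 :: "real^'d \<Rightarrow> real \<Rightarrow> real \<Rightarrow> real^'d"
    and b0 :: "real^'d \<Rightarrow> real \<Rightarrow> real \<Rightarrow> real"
    and u0 :: "real^'d \<Rightarrow> real"
    and f :: "real \<Rightarrow> real^'d \<Rightarrow> real"
  assumes "smooth_convex_domain \<Omega>"
    and "T > 0" and "0 < \<alpha>" and "\<alpha> < 1" and "\<delta> \<ge> 1"
    and "L_M-lipschitz_on {0<..} M"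
    and "(M \<longlongrightarrow> M 0) (at_right 0)"
    and "memory_coefficients T \<Omega> b2 b1 b0"
    and "u0 \<in> H2 \<Omega> \<inter> H10 \<Omega>"
    and "f \<in> bochner_Linf T (L2 \<Omega>) (l2_norm \<Omega>)"
    and "m0 > 0"
    and "\<And>s. s > 0 \<Longrightarrow> M s \<ge> m0"
    and "K = h1_norm \<Omega> u0 + linf_norm T (l2_norm \<Omega>) f"
    and "m0 - 4 * L_M * K\<^sup>2 > 0"
  shows "\<exists>C>0. \<forall>u.
           is_weak_solution \<alpha> T \<Omega> M b2 b1 b0 u0 f u \<and>
           (\<forall>x\<in>\<Omega>. time_regular T \<alpha> C0 (\<lambda>t. u t x)) \<longrightarrow>
           (\<forall>N. \<forall>n\<in>{2..N}. \<forall>x\<in>\<Omega>.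
              \<bar>linearization_error T \<delta> N (\<lambda>t. u t x) n\<bar>
                \<le> C * real N powr (- min (\<delta> * \<alpha>) 2))"
proof -
  \<comment> \<open>The constant is chosen before any u is given, when the sign of \<open>C0\<close>
    is still unknown; hence the absolute value. A regular function later forces \<open>C0\<close> to
    be nonnegative. The summand 1 in \<open>A + B + 1\<close> keeps the constant positive even if
    \<open>C0 = 0\<close>.\<close>
  define A where "A = (1 + 2 powr \<delta>) * \<bar>C0\<bar> * (T * 2 powr \<delta> + (T * 2 powr \<delta>) powr \<alpha> / \<alpha>)"
  define B where "B = 2 * \<bar>C0\<bar> * (T * \<delta>)\<^sup>2 * (1 + (T / 3 powr \<delta>) powr (\<alpha> - 2))"
  have AB: "A \<ge> 0" "B \<ge> 0"
    using assms by (auto simp: A_def B_def)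
  have "\<bar>linearization_error T \<delta> N y n\<bar> \<le> (A + B + 1) * real N powr (- min (\<delta> * \<alpha>) 2)"
    if reg: "time_regular T \<alpha> C0 y" and n: "n \<in> {2..N}" for y N n
  proof -
    let ?e = "real N powr (- min (\<delta> * \<alpha>) 2)"
    have C0: "\<bar>C0\<bar> = C0"
      using time_regular_const_nonneg[OF reg \<open>T > 0\<close>] by simp
    have "\<bar>linearization_error T \<delta> N y n\<bar> \<le> max A B * ?e"
    proof (cases "n = 2")
      case True
      have "\<bar>linearization_error T \<delta> N y n\<bar> \<le> A * ?e"
        using linearization_error_second_le[OF reg, of \<delta> N] assms n
        unfolding True A_def C0 by simp
      also have "\<dots> \<le> max A B * ?e" by (intro mult_right_mono) auto
      finally show ?thesis .
    next
      case False
      have "\<bar>linearization_error T \<delta> N y n\<bar> \<le> B * ?e"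
        using linearization_error_later_le[OF reg, of \<delta> n N] assms n False
        unfolding B_def C0 by simp
      also have "\<dots> \<le> max A B * ?e" by (intro mult_right_mono) auto
      finally show ?thesis .
    qed
    also have "\<dots> \<le> (A + B + 1) * ?e"
      using AB by (intro mult_right_mono) auto
    finally show ?thesis .
  qed
  then show ?thesis
    using AB by (intro exI[of _ "A + B + 1"]) auto
qed

end
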